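(* Let $\ell_0>0$. For each $\ell\ge\ell_0$ let $R=R_\ell$ be a collar or half-collar about a simple closed geodesic of length $\ell$ on a hyperbolic Riemann surface, and let $\Gamma_R$ be the family of curves in $R$ connecting the two boundary components of $R$. Let $f_\ell,g_\ell$ be the functions whose graphs are the lifts of the boundary components of $R$ to the universal covering $\tilde R$ in logarithmic coordinates, and assume $\{(f_\ell,g_\ell)\}_{\ell\ge\ell_0}$ is a simply degenerate family. Let $\Gamma_\ell^v$ be the family of vertical segments above $[-\frac12,\frac12]$ connecting the graphs of $f_\ell$ and $g_\ell$. If there exists a positive real-valued function $\delta=\delta(\ell)$, bounded above by $1$, such that (1) $d=\inf_{\ell\ge\ell_0}\delta(\ell)^2\,\mathrm{mod}\,\Gamma_\ell^v>0$, and (2) $c=\inf_{\ell\ge\ell_0}c_{\delta(\ell),\ell}>0$, then $$\mathrm{mod}\,\Gamma_R\asymp\mathrm{mod}\,\Gamma_\ell^v\quad\text{as }\ell\to\infty,$$ i.e. the ratio of the two sides lies between $C^{-1}$ and $C$ for all sufficiently large $\ell$, where the bound on the constant $C\ge1$ depends on $c$ and $d$ (and goes to infinity when either of them goes to zero).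
   Context: For a family $\Gamma$ of curves, $\mathrm{mod}\,\Gamma=\inf_\rho\iint\rho^2\,dx\,dy$ over nonnegative Borel metrics $\rho|dz|$ with $\int_\gamma\rho|dz|\ge1$ for every $\gamma\in\Gamma$. A collar about a simple closed geodesic $\alpha$ is an annular (doubly connected) open neighborhood of $\alpha$; a half-collar is an annular region having $\alpha$ as one of its boundary components. Logarithmic coordinates: take the upper half-plane as universal cover so that the positive imaginary axis covers $\alpha$ with deck transformation $w\mapsto e^{\ell}w$, $\ell=\ell(\alpha)$; $\tilde R$ is the image under $z=\frac1\ell\log w$ of the component of the preimage of $R$ containing (or, for a half-collar, bounded by) the positive imaginary axis. Then $\tilde R$ is invariant under $z\mapsto z+1$ and $\tilde R/\langle z\mapsto z+1\rangle=R$. It is understood that $\tilde R$ is the region between the graphs of two continuous functions $f_\ell>g_\ell$ on $\mathbb R$ of period $1$. The family $\{(f_\ell,g_\ell)\}_{\ell\ge\ell_0}$ is simply degenerate if $f_\ell>g_\ell$ everywhere for all $\ell\ge\ell_0$, $f_\ell$ and $g_\ell$ converge pointwise to $0$ as $\ell\to\infty$, and the Euclidean area between their graphs above $[-\frac12,\frac12]$ is at most $1$ for all $\ell$. For $\delta>0$, $$c_{\delta,\ell}=\inf_{x\in\mathbb R}\frac{\min_{a,b\in[x-\delta,x+\delta]}\,[f_\ell(a)-g_\ell(b)]}{f_\ell(x)-g_\ell(x)}.$$ *)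

theory Defs
  imports "HOL-Complex_Analysis.Complex_Analysis" "HOL-Algebra.Bij"
begin

section \<open>Moduli of curve families\<close>

definition curve_length :: "(real \<Rightarrow> complex) \<Rightarrow> real \<Rightarrow> real \<Rightarrow> ennreal" where
  "curve_length \<gamma> a b =
     (SUP (n, p) \<in> UNIV \<times> {p :: nat \<Rightarrow> real. mono p \<and> range p \<subseteq> {a..b}}.
        \<Sum>i<n. ennreal (dist (\<gamma> (p i)) (\<gamma> (p (Suc i)))))"

definition rectifiable :: "(real \<Rightarrow> complex) \<Rightarrow> bool" where
  "rectifiable \<gamma> \<longleftrightarrow> path \<gamma> \<and> curve_length \<gamma> 0 1 < \<infinity>"

text \<open>Parametrisation by arc length. For rectifiable \<open>\<gamma>\<close> the length function
  \<open>t \<mapsto> curve_length \<gamma> 0 t\<close> is continuous, so the infimum below is the first parameter at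
  which the length \<open>s\<close> has been traversed.\<close>

definition arc_param :: "(real \<Rightarrow> complex) \<Rightarrow> real \<Rightarrow> complex" where
  "arc_param \<gamma> s = \<gamma> (Inf {t \<in> {0..1}. ennreal s \<le> curve_length \<gamma> 0 t})"

definition line_integral :: "(complex \<Rightarrow> ennreal) \<Rightarrow> (real \<Rightarrow> complex) \<Rightarrow> ennreal" where
  "line_integral \<rho> \<gamma> =
     (\<integral>\<^sup>+ s \<in> {0..enn2real (curve_length \<gamma> 0 1)}. \<rho> (arc_param \<gamma> s) \<partial>lborel)"

text \<open>As usual, the condition on \<open>\<rho>\<close> is imposed on the rectifiable members of the family
  only, since \<open>|dz|\<close> is defined for these.\<close>

definition admissible :: "(real \<Rightarrow> complex) set \<Rightarrow> (complex \<Rightarrow> ennreal) \<Rightarrow> bool" where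
  "admissible \<Gamma> \<rho> \<longleftrightarrow> \<rho> \<in> borel_measurable borel \<and>
     (\<forall>\<gamma>\<in>\<Gamma>. rectifiable \<gamma> \<longrightarrow> 1 \<le> line_integral \<rho> \<gamma>)"

definition modulus :: "(real \<Rightarrow> complex) set \<Rightarrow> ennreal" where
  "modulus \<Gamma> = (INF \<rho> \<in> {\<rho>. admissible \<Gamma> \<rho>}. \<integral>\<^sup>+ z. (\<rho> z)\<^sup>2 \<partial>lborel)"

text \<open>Modulus of a family of curves on the Riemann surface \<open>\<complex>/\<langle>z \<mapsto> z + 1\<rangle>\<close>.
  Curves on this surface are given by their lifts to \<open>\<complex>\<close>, and a metric \<open>\<rho>|dz|\<close> on it is a
  metric on \<open>\<complex>\<close> invariant under \<open>z \<mapsto> z + 1\<close>; area is measured over one period.\<close>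

definition cylinder_modulus :: "(real \<Rightarrow> complex) set \<Rightarrow> ennreal" where
  "cylinder_modulus \<Gamma> =
     (INF \<rho> \<in> {\<rho>. admissible \<Gamma> \<rho> \<and> (\<forall>z. \<rho> (z + 1) = \<rho> z)}.
        \<integral>\<^sup>+ z \<in> {z. - (1/2) \<le> Re z \<and> Re z < 1/2}. (\<rho> z)\<^sup>2 \<partial>lborel)"


section \<open>Hyperbolic Riemann surfaces\<close>

definition upper_half_plane :: "complex set" where
  "upper_half_plane = {w. Im w > 0}"

text \<open>Deck groups of universal coverings of hyperbolic Riemann surfaces by the upper half-plane:
  groups of conformal automorphisms acting freely and properly discontinuously. The surface is
  the orbit space with the quotient topology.\<close>

definition deck_group :: "(complex \<Rightarrow> complex) set \<Rightarrow> bool" where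
  "deck_group G \<longleftrightarrow> subgroup G (BijGroup upper_half_plane) \<and>
     (\<forall>h\<in>G. h holomorphic_on upper_half_plane) \<and>
     (\<forall>h\<in>G. \<forall>w\<in>upper_half_plane. h w = w \<longrightarrow> h = (\<lambda>u\<in>upper_half_plane. u)) \<and>
     (\<forall>K. compact K \<and> K \<subseteq> upper_half_plane \<longrightarrow> finite {h\<in>G. h ` K \<inter> K \<noteq> {}})"

definition covering_proj :: "(complex \<Rightarrow> complex) set \<Rightarrow> complex \<Rightarrow> complex set" where
  "covering_proj G w = (\<lambda>h. h w) ` G"

definition covering_preimage :: "(complex \<Rightarrow> complex) set \<Rightarrow> complex set set \<Rightarrow> complex set" where
  "covering_preimage G A = {w \<in> upper_half_plane. covering_proj G w \<in> A}"

definition surface :: "(complex \<Rightarrow> complex) set \<Rightarrow> complex set topology" where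
  "surface G = topology (\<lambda>U. U \<subseteq> covering_proj G ` upper_half_plane \<and> open (covering_preimage G U))"

lemma openin_surface:
  "openin (surface G) U \<longleftrightarrow>
     U \<subseteq> covering_proj G ` upper_half_plane \<and> open (covering_preimage G U)"
proof -
  have "covering_preimage G (S \<inter> T) = covering_preimage G S \<inter> covering_preimage G T" for S T
    by (auto simp: covering_preimage_def)
  moreover have "covering_preimage G (\<Union>\<K>) = (\<Union>K\<in>\<K>. covering_preimage G K)" for \<K>
    by (auto simp: covering_preimage_def)
  ultimately have "istopology (\<lambda>U. U \<subseteq> covering_proj G ` upper_half_plane \<and>
      open (covering_preimage G U))"
    unfolding istopology_def by auto
  then show ?thesis
    by (simp add: surface_def)
qed


section \<open>Collars and half-collars about a simple closed geodesic\<close>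

definition imaginary_axis :: "complex set" where
  "imaginary_axis = (\<lambda>y. \<i> * of_real y) ` {0<..}"

text \<open>The positive imaginary axis covers a simple closed geodesic of length \<open>l\<close>, the
  corresponding deck transformation being \<open>w \<mapsto> exp l * w\<close>. The curve
  \<open>t \<mapsto> \<i> * exp t\<close> has unit hyperbolic speed.\<close>

definition axis_simple_closed_geodesic :: "(complex \<Rightarrow> complex) set \<Rightarrow> real \<Rightarrow> bool" where
  "axis_simple_closed_geodesic G l \<longleftrightarrow>
     (\<lambda>w\<in>upper_half_plane. of_real (exp l) * w) \<in> G \<and>
     inj_on (\<lambda>t. covering_proj G (\<i> * of_real (exp t))) {0..<l}"

definition annular_region :: "(complex \<Rightarrow> complex) set \<Rightarrow> complex set set \<Rightarrow> bool" where
  "annular_region G R \<longleftrightarrow> openin (surface G) R \<and>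
     subtopology (surface G) R homeomorphic_space
       top_of_set {z :: complex. 1 < norm z \<and> norm z < 2}"

definition collar :: "(complex \<Rightarrow> complex) set \<Rightarrow> complex set set \<Rightarrow> bool" where
  "collar G R \<longleftrightarrow> annular_region G R \<and> covering_proj G ` imaginary_axis \<subseteq> R"

text \<open>Boundary components of an annular region are understood as those of its lift: in the
  surface itself the two boundary curves may touch each other (or themselves), in which case they
  are not connected components of the frontier.\<close>

definition axis_bounds :: "complex set \<Rightarrow> bool" where
  "axis_bounds W \<longleftrightarrow> imaginary_axis \<in> components (upper_half_plane \<inter> frontier W)"

definition half_collar :: "(complex \<Rightarrow> complex) set \<Rightarrow> complex set set \<Rightarrow> bool" where
  "half_collar G R \<longleftrightarrow> annular_region G R \<and>
     (\<exists>W \<in> components (covering_preimage G R). axis_bounds W)"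

definition log_coordinate :: "real \<Rightarrow> complex \<Rightarrow> complex" where
  "log_coordinate l w = Ln w / of_real l"

text \<open>\<open>T\<close> is the lift of the (half-)collar \<open>R\<close> in logarithmic coordinates.\<close>

definition log_lift ::
    "(complex \<Rightarrow> complex) set \<Rightarrow> real \<Rightarrow> complex set set \<Rightarrow> complex set \<Rightarrow> bool" where
  "log_lift G l R T \<longleftrightarrow>
     (\<exists>W \<in> components (covering_preimage G R).
        (collar G R \<and> imaginary_axis \<subseteq> W \<or> half_collar G R \<and> axis_bounds W) \<and>
        T = log_coordinate l ` W)"

definition graph_of :: "(real \<Rightarrow> real) \<Rightarrow> complex set" where
  "graph_of f = range (\<lambda>x. Complex x (f x))"

definition region_between :: "(real \<Rightarrow> real) \<Rightarrow> (real \<Rightarrow> real) \<Rightarrow> complex set" where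
  "region_between f g = {z. g (Re z) < Im z \<and> Im z < f (Re z)}"

definition boundary_functions :: "complex set \<Rightarrow> (real \<Rightarrow> real) \<Rightarrow> (real \<Rightarrow> real) \<Rightarrow> bool" where
  "boundary_functions T f g \<longleftrightarrow>
     continuous_on UNIV f \<and> continuous_on UNIV g \<and>
     (\<forall>x. f (x + 1) = f x) \<and> (\<forall>x. g (x + 1) = g x) \<and>
     (\<forall>x. g x < f x) \<and> T = region_between f g"

text \<open>The curves in \<open>R = T/\<langle>z \<mapsto> z + 1\<rangle>\<close> connecting the two boundary components, given by
  their lifts: one endpoint on each boundary graph and all other points in \<open>T\<close>. Curves are
  unoriented, so they are parametrised from the lower to the upper graph.\<close>

definition connecting_curves ::
    "complex set \<Rightarrow> (real \<Rightarrow> real) \<Rightarrow> (real \<Rightarrow> real) \<Rightarrow> (real \<Rightarrow> complex) set" where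
  "connecting_curves T f g =
     {\<gamma>. path \<gamma> \<and> pathstart \<gamma> \<in> graph_of g \<and> pathfinish \<gamma> \<in> graph_of f \<and>
         (\<forall>t\<in>{0<..<1}. \<gamma> t \<in> T)}"

definition vertical_segments :: "(real \<Rightarrow> real) \<Rightarrow> (real \<Rightarrow> real) \<Rightarrow> (real \<Rightarrow> complex) set" where
  "vertical_segments f g = (\<lambda>x. linepath (Complex x (g x)) (Complex x (f x))) ` {- (1/2)..1/2}"


section \<open>Simply degenerate families\<close>

definition simply_degenerate ::
    "real \<Rightarrow> (real \<Rightarrow> real \<Rightarrow> real) \<Rightarrow> (real \<Rightarrow> real \<Rightarrow> real) \<Rightarrow> bool" where
  "simply_degenerate l0 f g \<longleftrightarrow>
     (\<forall>l\<ge>l0. \<forall>x. g l x < f l x) \<and>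
     (\<forall>x. ((\<lambda>l. f l x) \<longlongrightarrow> 0) at_top \<and> ((\<lambda>l. g l x) \<longlongrightarrow> 0) at_top) \<and>
     (\<forall>l\<ge>l0. emeasure lborel
        (region_between (f l) (g l) \<inter> {z. - (1/2) \<le> Re z \<and> Re z \<le> 1/2}) \<le> 1)"

text \<open>Extended reals are used because the infimum of \<open>c_const\<close> over a family need not be bounded
  below; the inner infimum is a minimum for continuous \<open>f\<close>, \<open>g\<close>.\<close>

definition c_const :: "(real \<Rightarrow> real) \<Rightarrow> (real \<Rightarrow> real) \<Rightarrow> real \<Rightarrow> ereal" where
  "c_const f g \<delta> =
     (INF x. (INF (a, b) \<in> {x - \<delta>..x + \<delta>} \<times> {x - \<delta>..x + \<delta>}. ereal (f a - g b))
             / ereal (f x - g x))"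

end

theory Submission
  imports Defs
begin

text \<open>Write \<open>h = f - g\<close> for the height of the region between the two graphs. The comparison is a
  length-area argument at each fixed \<open>l \<ge> l0\<close>; integrals below are over one period.

  Vertical segments are connecting curves, so enlarging the family from the former to the latter
  can only raise the modulus (\<open>modulus_vertical_segments_le_cylinder_modulus\<close>); this bounds the
  ratio below by 1. For an upper bound, a metric that every connecting curve finds long is needed.
  A curve whose horizontal extent is at most \<open>\<delta>\<close> rises from \<open>g b\<close> to \<open>f a\<close> with \<open>a\<close>, \<open>b\<close> within \<open>\<delta>\<close>
  of every abscissa \<open>x\<close> it visits, so by the definition of \<open>c\<close> it has length at least \<open>c h(x)\<close>; any
  other curve has length at least \<open>\<delta>\<close>. Hence the density \<open>max (1/(c h(x))) (1/\<delta>)\<close> on the region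
  is admissible, and its area is at most
  \<open>(1/c\<^sup>2) \<integral> 1/h + (1/\<delta>\<^sup>2) \<integral> h\<close>.
  The first integral is at most the modulus \<open>M\<close> of the vertical segments, by the Cauchy-Schwarz
  inequality on each segment (\<open>modulus_vertical_segments_ge\<close>). The second is the area of the
  region, at most 1, and \<open>d \<le> \<delta>\<^sup>2 M\<close> gives \<open>1/\<delta>\<^sup>2 \<le> M/d\<close>. So the ratio
  lies between 1 and \<open>1/c\<^sup>2 + 1/d\<close> (\<open>modulus_comparison\<close>).\<close>

section \<open>Iterated integration over the complex plane\<close>

lemma distr_lborel_Complex:
  "distr (lborel :: (real \<times> real) measure) borel (\<lambda>p. Complex (fst p) (snd p)) = lborel"
proof (rule lborel_eqI[symmetric])
  have meas[measurable]: "(\<lambda>p. Complex (fst p) (snd p)) \<in> borel_measurable (borel :: (real \<times> real) measure)"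
    by (intro borel_measurable_continuous_onI continuous_intros)
  fix l u :: complex
  assume le: "\<And>b. b \<in> Basis \<Longrightarrow> l \<bullet> b \<le> u \<bullet> b"
  have vim: "(\<lambda>p. Complex (fst p) (snd p)) -` box l u = box (Re l, Im l) (Re u, Im u)"
    by (auto simp: in_box_complex_iff mem_box Basis_prod_def)
  have "Re l \<le> Re u" "Im l \<le> Im u"
    using le[of 1] le[of \<i>] by (auto simp: Basis_complex_def)
  then have "emeasure lborel (box (Re l, Im l) (Re u, Im u)) = ennreal ((Re u - Re l) * (Im u - Im l))"
    by (subst emeasure_lborel_box)
      (auto simp: Basis_prod_def prod.union_disjoint prod.reindex inj_on_def)
  then show "emeasure (distr lborel borel (\<lambda>p. Complex (fst p) (snd p))) (box l u)
      = ennreal (\<Prod>b\<in>Basis. (u - l) \<bullet> b)"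
    by (simp add: emeasure_distr vim Basis_complex_def)
qed simp

lemma nn_integral_complex_iterated:
  assumes [measurable]: "F \<in> borel_measurable (borel :: complex measure)"
  shows "(\<integral>\<^sup>+z. F z \<partial>lborel) = (\<integral>\<^sup>+x. \<integral>\<^sup>+y. F (Complex x y) \<partial>lborel \<partial>lborel)"
proof -
  have meas[measurable]: "(\<lambda>p. Complex (fst p) (snd p)) \<in> borel_measurable (borel :: (real \<times> real) measure)"
    by (intro borel_measurable_continuous_onI continuous_intros)
  have "(\<integral>\<^sup>+z. F z \<partial>lborel) = (\<integral>\<^sup>+p. F (Complex (fst p) (snd p)) \<partial>(lborel :: (real \<times> real) measure))"
    by (subst distr_lborel_Complex[symmetric]) (subst nn_integral_distr; simp)
  also have "\<dots> = (\<integral>\<^sup>+p. F (Complex (fst p) (snd p)) \<partial>((lborel :: real measure) \<Otimes>\<^sub>M (lborel :: real measure)))"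
    by (simp only: lborel_prod)
  also have "\<dots> = (\<integral>\<^sup>+x. \<integral>\<^sup>+y. F (Complex x y) \<partial>lborel \<partial>lborel)"
    by (subst lborel.nn_integral_fst[symmetric]) (simp_all add: lborel_prod)
  finally show ?thesis .
qed

section \<open>Length and line integrals\<close>

lemma dist_le_curve_length:
  assumes "s \<in> {a..b}" "t \<in> {a..b}"
  shows "ennreal (dist (\<gamma> s) (\<gamma> t)) \<le> curve_length \<gamma> a b"
proof -
  have *: "ennreal (dist (\<gamma> s) (\<gamma> t)) \<le> curve_length \<gamma> a b" if "s \<in> {a..b}" "t \<in> {a..b}" "s \<le> t" for s t
  proof -
    let ?p = "\<lambda>i::nat. if i = 0 then s else t"
    have "mono ?p" using that by (auto simp: mono_def)
    moreover have "range ?p \<subseteq> {a..b}" using that by auto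
    ultimately have "(case (1, ?p) of (n, p) \<Rightarrow> \<Sum>i<n. ennreal (dist (\<gamma> (p i)) (\<gamma> (p (Suc i)))))
        \<le> curve_length \<gamma> a b"
      unfolding curve_length_def by (intro SUP_upper) auto
    then show ?thesis by simp
  qed
  show ?thesis
    using *[of s t] *[of t s] assms by (cases "s \<le> t") (auto simp: dist_commute)
qed

lemma curve_length_vertical:
  assumes "u \<le> v" "0 \<le> t"
  shows "curve_length (linepath (Complex x u) (Complex x v)) 0 t = ennreal ((v - u) * t)"
proof (rule antisym)
  let ?\<gamma> = "linepath (Complex x u) (Complex x v)"
  have \<gamma>: "?\<gamma> s = Complex x (u + (v - u) * s)" for s
    by (simp add: linepath_def complex_eq_iff algebra_simps)
  have d: "dist (?\<gamma> r) (?\<gamma> s) = (v - u) * \<bar>r - s\<bar>" for r s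
  proof -
    have "?\<gamma> r - ?\<gamma> s = Complex 0 ((v - u) * (r - s))"
      by (simp add: \<gamma> complex_eq_iff algebra_simps)
    then show ?thesis using assms by (simp add: dist_norm complex_norm abs_mult)
  qed
  show "curve_length ?\<gamma> 0 t \<le> ennreal ((v - u) * t)"
    unfolding curve_length_def
  proof (rule SUP_least, clarify)
    fix n and p :: "nat \<Rightarrow> real"
    assume p: "mono p" "range p \<subseteq> {0..t}"
    have "(\<Sum>i<n. ennreal (dist (?\<gamma> (p i)) (?\<gamma> (p (Suc i))))) = (\<Sum>i<n. ennreal ((v - u) * (p (Suc i) - p i)))"
      using p(1) by (intro sum.cong) (auto simp: d mono_def)
    also have "\<dots> = ennreal (\<Sum>i<n. (v - u) * (p (Suc i) - p i))"
      using p(1) assms by (intro sum_ennreal) (auto simp: mono_def)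
    also have "(\<Sum>i<n. (v - u) * (p (Suc i) - p i)) = (v - u) * (p n - p 0)"
      by (simp add: sum_distrib_left[symmetric] sum_lessThan_telescope)
    also have "ennreal \<dots> \<le> ennreal ((v - u) * t)"
    proof -
      have "p n \<in> {0..t}" "p 0 \<in> {0..t}" using p(2) by blast+
      then show ?thesis using assms by (intro ennreal_leI mult_left_mono) auto
    qed
    finally show "(\<Sum>i<n. ennreal (dist (?\<gamma> (p i)) (?\<gamma> (p (Suc i))))) \<le> ennreal ((v - u) * t)" .
  qed
  show "ennreal ((v - u) * t) \<le> curve_length ?\<gamma> 0 t"
    using dist_le_curve_length[of 0 0 t t ?\<gamma>] assms unfolding d by simp
qed

text \<open>A vertical segment traversed upwards has constant speed, so its arc length parameter differs
  from the ordinate only by a translation.\<close>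

lemma line_integral_vertical:
  assumes "u < v" and [measurable]: "\<rho> \<in> borel_measurable borel"
  shows "line_integral \<rho> (linepath (Complex x u) (Complex x v))
    = (\<integral>\<^sup>+y\<in>{u..v}. \<rho> (Complex x y) \<partial>lborel)"
proof -
  let ?\<gamma> = "linepath (Complex x u) (Complex x v)"
  have [measurable]: "(\<lambda>y. Complex x y) \<in> borel_measurable borel"
    by (intro borel_measurable_continuous_onI continuous_intros)
  have L: "curve_length ?\<gamma> 0 t = ennreal ((v - u) * t)" if "0 \<le> t" for t
    using curve_length_vertical[of u v t x] assms that by simp
  have arc: "arc_param ?\<gamma> s = Complex x (u + s)" if "s \<in> {0..v - u}" for s
  proof -
    have "ennreal s \<le> curve_length ?\<gamma> 0 t \<longleftrightarrow> s / (v - u) \<le> t" if "0 \<le> t" for t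
      using that assms(1) by (simp add: L ennreal_le_iff pos_divide_le_eq mult.commute)
    moreover have "0 \<le> s / (v - u)" using that assms(1) by simp
    ultimately have "{t \<in> {0..1}. ennreal s \<le> curve_length ?\<gamma> 0 t} = {s / (v - u)..1}"
      by auto
    moreover have "s / (v - u) \<le> 1" using that assms by simp
    ultimately have "arc_param ?\<gamma> s = ?\<gamma> (s / (v - u))"
      by (simp add: arc_param_def)
    also have "\<dots> = Complex x (u + s / (v - u) * (v - u))"
      unfolding linepath_def by (simp add: complex_eq_iff left_diff_distrib right_diff_distrib diff_divide_distrib)
    finally show ?thesis using assms(1) by simp
  qed
  have "(\<integral>\<^sup>+y\<in>{u..v}. \<rho> (Complex x y) \<partial>lborel)
      = (\<integral>\<^sup>+s. \<rho> (Complex x (u + s)) * indicator {u..v} (u + s) \<partial>lborel)"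
    by (subst nn_integral_real_affine[where t = u and c = 1]) auto
  also have "\<dots> = (\<integral>\<^sup>+s\<in>{0..v - u}. \<rho> (arc_param ?\<gamma> s) \<partial>lborel)"
    by (intro nn_integral_cong) (auto simp: arc split: split_indicator)
  also have "\<dots> = line_integral \<rho> ?\<gamma>"
    using assms by (simp add: line_integral_def L)
  finally show ?thesis ..
qed

lemma rectifiable_vertical:
  assumes "u \<le> v"
  shows "rectifiable (linepath (Complex x u) (Complex x v))"
  using assms by (simp add: rectifiable_def curve_length_vertical)

section \<open>Lower bounds\<close>

text \<open>On the segment above \<open>x\<close>, admissibility and the Cauchy-Schwarz inequality give
  \<open>1 \<le> (\<integral> \<rho> dy)\<^sup>2 \<le> h(x) \<integral> \<rho>\<^sup>2 dy\<close>. Divide by \<open>h(x)\<close> and integrate over \<open>x\<close>.\<close>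

lemma modulus_vertical_segments_ge:
  assumes contf: "continuous_on UNIV f" and contg: "continuous_on UNIV g" and less: "\<And>x. g x < f x"
  shows "(\<integral>\<^sup>+x\<in>{- (1/2)..1/2}. ennreal (1 / (f x - g x)) \<partial>lborel) \<le> modulus (vertical_segments f g)"
  unfolding modulus_def
proof (rule INF_greatest, clarify)
  fix \<rho> assume adm: "admissible (vertical_segments f g) \<rho>"
  then have [measurable]: "\<rho> \<in> borel_measurable borel"
    by (simp add: admissible_def)
  have [measurable]: "(\<lambda>y. Complex x y) \<in> borel_measurable borel" for x
    by (intro borel_measurable_continuous_onI continuous_intros)
  have "ennreal (1 / (f x - g x)) \<le> (\<integral>\<^sup>+y. (\<rho> (Complex x y))\<^sup>2 \<partial>lborel)" (is "_ \<le> ?Q")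
    if x: "x \<in> {- (1/2)..1/2}" for x
  proof -
    let ?\<gamma> = "linepath (Complex x (g x)) (Complex x (f x))"
    have h: "0 < f x - g x" using less[of x] by simp
    have "?\<gamma> \<in> vertical_segments f g"
      using x by (auto simp: vertical_segments_def)
    then have "1 \<le> line_integral \<rho> ?\<gamma>"
      using adm less[of x] by (auto simp: admissible_def rectifiable_vertical less_imp_le)
    also have "\<dots> = (\<integral>\<^sup>+y. \<rho> (Complex x y) * indicator {g x..f x} y \<partial>lborel)"
      using less[of x] by (simp add: line_integral_vertical)
    finally have "1 \<le> (\<integral>\<^sup>+y. \<rho> (Complex x y) * indicator {g x..f x} y \<partial>lborel)\<^sup>2"
      by (simp add: one_le_power)
    also have "\<dots> \<le> ?Q * (\<integral>\<^sup>+y. (indicator {g x..f x} y)\<^sup>2 \<partial>lborel)"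
      by (rule Cauchy_Schwarz_nn_integral) measurable
    also have "(\<integral>\<^sup>+y. (indicator {g x..f x} y)\<^sup>2 \<partial>lborel) = (\<integral>\<^sup>+y. indicator {g x..f x} y \<partial>lborel)"
      by (intro nn_integral_cong) (auto split: split_indicator)
    also have "\<dots> = ennreal (f x - g x)"
      using less[of x] by simp
    finally have "1 * ennreal (1 / (f x - g x)) \<le> ?Q * ennreal (f x - g x) * ennreal (1 / (f x - g x))"
      by (rule mult_right_mono) simp
    also have "\<dots> = ?Q"
      using h by (simp add: mult.assoc flip: ennreal_mult)
    finally show ?thesis by simp
  qed
  then have "(\<integral>\<^sup>+x\<in>{- (1/2)..1/2}. ennreal (1 / (f x - g x)) \<partial>lborel)
      \<le> (\<integral>\<^sup>+x. \<integral>\<^sup>+y. (\<rho> (Complex x y))\<^sup>2 \<partial>lborel \<partial>lborel)"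
    by (intro nn_integral_mono) (auto split: split_indicator)
  also have "\<dots> = (\<integral>\<^sup>+z. (\<rho> z)\<^sup>2 \<partial>lborel)"
    by (rule nn_integral_complex_iterated[symmetric]) measurable
  finally show "(\<integral>\<^sup>+x\<in>{- (1/2)..1/2}. ennreal (1 / (f x - g x)) \<partial>lborel) \<le> (\<integral>\<^sup>+z. (\<rho> z)\<^sup>2 \<partial>lborel)" .
qed

lemma vertical_segments_subset_connecting_curves:
  assumes "\<And>x. g x < f x"
  shows "vertical_segments f g \<subseteq> connecting_curves (region_between f g) f g"
proof -
  have "linepath (Complex x (g x)) (Complex x (f x)) t \<in> region_between f g"
    if t: "0 < t" "t < 1" for x t
  proof -
    have "0 < t * (f x - g x)" "0 < (1 - t) * (f x - g x)"
      using t assms[of x] by simp_all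
    then show ?thesis
      by (simp add: region_between_def linepath_def complex_eq_iff algebra_simps)
  qed
  then show ?thesis
    by (auto simp: vertical_segments_def connecting_curves_def graph_of_def)
qed

text \<open>A periodic metric that is admissible on the cylinder stays admissible for the vertical segments
  when it is cut off outside one period, which makes its planar area equal to its area on the
  cylinder. The period is half-open while the segments stand above a closed interval; the last
  segment is accommodated by an infinite density on its line, which has measure zero.\<close>

lemma modulus_vertical_segments_le_cylinder_modulus:
  assumes less: "\<And>x. g x < f x" and sub: "vertical_segments f g \<subseteq> \<Gamma>"
  shows "modulus (vertical_segments f g) \<le> cylinder_modulus \<Gamma>"
  unfolding cylinder_modulus_def
proof (rule INF_greatest, clarify)
  fix \<rho> :: "complex \<Rightarrow> ennreal" assume adm: "admissible \<Gamma> \<rho>"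
  let ?S = "{z :: complex. - (1/2) \<le> Re z \<and> Re z < 1/2}" and ?E = "{z :: complex. Re z = 1/2}"
  define \<sigma> where "\<sigma> z = \<rho> z * indicator ?S z + \<infinity> * indicator ?E z" for z
  have [measurable]: "\<rho> \<in> borel_measurable borel"
    using adm by (simp add: admissible_def)
  have [measurable]: "?S \<in> sets borel" "?E \<in> sets borel"
    by measurable
  have \<sigma>[measurable]: "\<sigma> \<in> borel_measurable borel"
    unfolding \<sigma>_def by measurable
  have "1 \<le> line_integral \<sigma> \<gamma>" if \<gamma>: "\<gamma> \<in> vertical_segments f g" for \<gamma>
  proof -
    obtain x where x: "x \<in> {- (1/2)..1/2}" and \<gamma>x: "\<gamma> = linepath (Complex x (g x)) (Complex x (f x))"
      using \<gamma> by (auto simp: vertical_segments_def)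
    have "1 \<le> line_integral \<rho> \<gamma>"
      using adm sub \<gamma> less[of x] by (auto simp: admissible_def \<gamma>x rectifiable_vertical less_imp_le)
    also have "\<dots> = (\<integral>\<^sup>+y\<in>{g x..f x}. \<rho> (Complex x y) \<partial>lborel)"
      unfolding \<gamma>x using less[of x] by (intro line_integral_vertical) auto
    also have "\<dots> \<le> (\<integral>\<^sup>+y\<in>{g x..f x}. \<sigma> (Complex x y) \<partial>lborel)"
      using x by (intro nn_integral_mono mult_right_mono) (auto simp: \<sigma>_def split: split_indicator)
    also have "\<dots> = line_integral \<sigma> \<gamma>"
      unfolding \<gamma>x using less[of x] by (intro line_integral_vertical[symmetric]) auto
    finally show ?thesis .
  qed
  then have "modulus (vertical_segments f g) \<le> (\<integral>\<^sup>+z. (\<sigma> z)\<^sup>2 \<partial>lborel)"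
    unfolding modulus_def by (intro INF_lower) (auto simp: admissible_def)
  also have "\<dots> = (\<integral>\<^sup>+z\<in>?S. (\<rho> z)\<^sup>2 \<partial>lborel)"
  proof (rule nn_integral_cong_AE)
    have "emeasure lborel ?E = (\<integral>\<^sup>+z. indicator ?E z \<partial>lborel)"
      by simp
    also have "\<dots> = (\<integral>\<^sup>+x. \<integral>\<^sup>+y. indicator ?E (Complex x y) \<partial>lborel \<partial>(lborel :: real measure))"
      by (rule nn_integral_complex_iterated) measurable
    also have "\<dots> = (\<integral>\<^sup>+x. \<infinity> * indicator {1/2::real} x \<partial>lborel)"
      by (intro nn_integral_cong) (auto split: split_indicator)
    also have "\<dots> = 0" by (subst nn_integral_cmult) auto
    finally have "?E \<in> null_sets lborel" by (simp add: null_sets_def)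
    then have "AE z in lborel. z \<notin> ?E" by (rule AE_not_in)
    then show "AE z in lborel. (\<sigma> z)\<^sup>2 = (\<rho> z)\<^sup>2 * indicator ?S z"
      by eventually_elim (auto simp: \<sigma>_def split: split_indicator)
  qed
  finally show "modulus (vertical_segments f g) \<le> (\<integral>\<^sup>+z\<in>?S. (\<rho> z)\<^sup>2 \<partial>lborel)" .
qed

section \<open>Upper bound for the modulus of the connecting curves\<close>

text \<open>Length-times-density estimate: \<open>arc_param\<close> only takes values on the curve, where the density
  is at least \<open>k\<close>, and the curve is at least as long as the distance of two of its points.\<close>

lemma line_integral_ge:
  assumes rect: "rectifiable \<gamma>" and st: "s \<in> {0..1}" "t \<in> {0..1}"
    and far: "r \<le> dist (\<gamma> s) (\<gamma> t)"
    and \<rho>: "\<And>t. t \<in> {0..1} \<Longrightarrow> ennreal k \<le> \<rho> (\<gamma> t)" and k: "0 \<le> k" "1 \<le> k * r"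
  shows "1 \<le> line_integral \<rho> \<gamma>"
proof -
  define L where "L = enn2real (curve_length \<gamma> 0 1)"
  have L: "curve_length \<gamma> 0 1 = ennreal L" "0 \<le> L"
    using rect by (simp_all add: L_def rectifiable_def less_top)
  have "r \<le> L"
    using dist_le_curve_length[OF st, of \<gamma>] far by (simp add: L)
  have \<rho>': "ennreal k \<le> \<rho> (arc_param \<gamma> u)" if u: "u \<in> {0..L}" for u
  proof -
    let ?A = "{t \<in> {0..1}. ennreal u \<le> curve_length \<gamma> 0 t}"
    have "1 \<in> ?A" using u by (simp add: L ennreal_leI)
    then have "Inf ?A \<in> {0..1}"
      by (auto intro!: cInf_greatest cInf_lower bdd_belowI[of _ 0])
    then show ?thesis by (simp add: arc_param_def \<rho>)
  qed
  have "1 \<le> ennreal (k * r)" using k by (metis ennreal_1 ennreal_leI)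
  also have "\<dots> \<le> ennreal (k * L)" using \<open>r \<le> L\<close> k by (intro ennreal_leI mult_left_mono)
  also have "\<dots> = (\<integral>\<^sup>+u\<in>{0..L}. ennreal k \<partial>lborel)"
    using L(2) k(1) by (simp add: nn_integral_cmult ennreal_mult)
  also have "\<dots> \<le> (\<integral>\<^sup>+u\<in>{0..L}. \<rho> (arc_param \<gamma> u) \<partial>lborel)"
    by (intro nn_integral_mono) (auto simp: \<rho>' split: split_indicator)
  also have "\<dots> = line_integral \<rho> \<gamma>"
    by (simp add: line_integral_def L_def)
  finally show ?thesis .
qed

text \<open>The density \<open>\<rho>\<close> below serves two kinds of curves: its part \<open>1/(c h)\<close> the ones that stay in a
  vertical strip of width \<open>\<delta>\<close>, its part \<open>1/\<delta>\<close> the ones that leave every such strip. Since the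
  square of a maximum is at most the sum of the squares, both parts contribute separately to the
  area.\<close>

lemma cylinder_modulus_connecting_curves_le:
  assumes contf: "continuous_on UNIV f" and contg: "continuous_on UNIV g"
    and perf: "\<And>x. f (x + 1) = f x" and perg: "\<And>x. g (x + 1) = g x"
    and less: "\<And>x. g x < f x" and pos: "0 < c" "0 < \<delta>"
    and narrow: "\<And>x a b. \<bar>a - x\<bar> \<le> \<delta> \<Longrightarrow> \<bar>b - x\<bar> \<le> \<delta> \<Longrightarrow> c * (f x - g x) \<le> f a - g b"
  shows "cylinder_modulus (connecting_curves (region_between f g) f g)
    \<le> ennreal (1 / c\<^sup>2) * (\<integral>\<^sup>+x\<in>{- (1/2)..1/2}. ennreal (1 / (f x - g x)) \<partial>lborel)
      + ennreal (1 / \<delta>\<^sup>2) * (\<integral>\<^sup>+x\<in>{- (1/2)..1/2}. ennreal (f x - g x) \<partial>lborel)"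
proof -
  have [measurable]: "f \<in> borel_measurable borel" "g \<in> borel_measurable borel"
    using contf contg by (auto intro: borel_measurable_continuous_onI)
  define m where "m x = max (1 / (c * (f x - g x))) (1 / \<delta>)" for x
  \<comment> \<open>The boundary graphs are included so that the density is also bounded below at the endpoints
    of the curves.\<close>
  define B where "B = {z. g (Re z) \<le> Im z \<and> Im z \<le> f (Re z)}"
  define \<rho> where "\<rho> z = ennreal (m (Re z)) * indicator B z" for z
  let ?S = "{z :: complex. - (1/2) \<le> Re z \<and> Re z < 1/2}"
  let ?\<Gamma> = "connecting_curves (region_between f g) f g"
  have [measurable]: "m \<in> borel_measurable borel" "B \<in> sets borel" "?S \<in> sets borel"
    unfolding m_def B_def by measurable
  have \<rho>[measurable]: "\<rho> \<in> borel_measurable borel"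
    unfolding \<rho>_def by measurable
  have m_pos: "0 < m x" for x
    using pos by (auto simp: m_def less_max_iff_disj)
  have "1 \<le> line_integral \<rho> \<gamma>" if \<gamma>: "\<gamma> \<in> ?\<Gamma>" and rect: "rectifiable \<gamma>" for \<gamma>
  proof -
    obtain a b where a: "\<gamma> 0 = Complex a (g a)" and b: "\<gamma> 1 = Complex b (f b)"
      and mid: "\<And>t. t \<in> {0<..<1} \<Longrightarrow> \<gamma> t \<in> region_between f g"
      using \<gamma> by (auto simp: connecting_curves_def graph_of_def pathstart_def pathfinish_def)
    have "\<gamma> t \<in> B" if "t \<in> {0..1}" for t
    proof -
      consider "t = 0" | "t = 1" | "t \<in> {0<..<1}" using \<open>t \<in> {0..1}\<close> by (force simp: less_le)
      then show ?thesis
        using a b mid less by cases (force simp: B_def region_between_def less_imp_le)+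
    qed
    then have \<rho>m: "\<rho> (\<gamma> t) = ennreal (m (Re (\<gamma> t)))" if "t \<in> {0..1}" for t
      using that by (simp add: \<rho>_def)
    show ?thesis
    proof (cases "\<forall>s\<in>{0..1}. \<forall>t\<in>{0..1}. \<bar>Re (\<gamma> s) - Re (\<gamma> t)\<bar> \<le> \<delta>")
      case True
      have near: "c * (f (Re (\<gamma> t)) - g (Re (\<gamma> t))) \<le> f b - g a" if "t \<in> {0..1}" for t
        using True[rule_format, of 0 t] True[rule_format, of 1 t] that a b
        by (intro narrow) auto
      have hpos: "0 < c * (f x - g x)" for x using pos less[of x] by simp
      have fb: "0 < f b - g a" using near[of 0] hpos[of "Re (\<gamma> 0)"] by (simp del: mult_pos_pos)
      show ?thesis
      proof (rule line_integral_ge[OF rect])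
        show "f b - g a \<le> dist (\<gamma> 0) (\<gamma> 1)"
          using abs_Im_le_cmod[of "\<gamma> 0 - \<gamma> 1"] a b by (simp add: dist_norm)
        show "ennreal (1 / (f b - g a)) \<le> \<rho> (\<gamma> t)" if "t \<in> {0..1}" for t
        proof -
          have "1 / (f b - g a) \<le> 1 / (c * (f (Re (\<gamma> t)) - g (Re (\<gamma> t))))"
            using near[OF that] hpos by (intro divide_left_mono) (auto intro: mult_pos_pos fb)
          then show ?thesis
            by (auto simp: \<rho>m[OF that] m_def intro!: ennreal_leI)
        qed
      qed (use fb in auto)
    next
      case False
      then obtain s t where st: "s \<in> {0..1}" "t \<in> {0..1}" "\<delta> < \<bar>Re (\<gamma> s) - Re (\<gamma> t)\<bar>"
        by (auto simp: not_le)
      show ?thesis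
      proof (rule line_integral_ge[OF rect st(1,2)])
        show "\<delta> \<le> dist (\<gamma> s) (\<gamma> t)"
          using abs_Re_le_cmod[of "\<gamma> s - \<gamma> t"] st by (simp add: dist_norm)
        show "ennreal (1 / \<delta>) \<le> \<rho> (\<gamma> t)" if "t \<in> {0..1}" for t
          by (auto simp: \<rho>m[OF that] m_def intro!: ennreal_leI)
      qed (use pos in auto)
    qed
  qed
  then have "admissible ?\<Gamma> \<rho>" by (simp add: admissible_def)
  moreover have "\<rho> (z + 1) = \<rho> z" for z
    by (simp add: \<rho>_def m_def B_def perf perg indicator_def)
  ultimately have "cylinder_modulus ?\<Gamma> \<le> (\<integral>\<^sup>+z\<in>?S. (\<rho> z)\<^sup>2 \<partial>lborel)"
    unfolding cylinder_modulus_def by (intro INF_lower) auto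
  also have "\<dots> = (\<integral>\<^sup>+x. \<integral>\<^sup>+y. (\<rho> (Complex x y))\<^sup>2 * indicator ?S (Complex x y) \<partial>lborel \<partial>lborel)"
    by (rule nn_integral_complex_iterated) measurable
  also have "\<dots> = (\<integral>\<^sup>+x. \<integral>\<^sup>+y. (ennreal ((m x)\<^sup>2) * indicator {- (1/2)..<1/2} x) * indicator {g x..f x} y \<partial>lborel \<partial>lborel)"
    using m_pos by (intro nn_integral_cong)
      (auto simp: \<rho>_def B_def ennreal_power less_imp_le split: split_indicator)
  also have "\<dots> = (\<integral>\<^sup>+x. ennreal ((m x)\<^sup>2) * indicator {- (1/2)..<1/2} x * ennreal (f x - g x) \<partial>lborel)"
    using less by (intro nn_integral_cong) (simp add: nn_integral_cmult less_imp_le)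
  also have "\<dots> \<le> (\<integral>\<^sup>+x. ennreal (1 / c\<^sup>2) * (ennreal (1 / (f x - g x)) * indicator {- (1/2)..1/2} x)
      + ennreal (1 / \<delta>\<^sup>2) * (ennreal (f x - g x) * indicator {- (1/2)..1/2} x) \<partial>lborel)"
  proof (rule nn_integral_mono)
    fix x :: real
    have h: "0 < f x - g x" using less[of x] by simp
    have "(m x)\<^sup>2 \<le> (1 / (c * (f x - g x)))\<^sup>2 + (1 / \<delta>)\<^sup>2"
      by (auto simp: m_def max_def)
    then have "(m x)\<^sup>2 * (f x - g x) \<le> ((1 / (c * (f x - g x)))\<^sup>2 + (1 / \<delta>)\<^sup>2) * (f x - g x)"
      using h by (intro mult_right_mono) auto
    also have "\<dots> = 1 / c\<^sup>2 * (1 / (f x - g x)) + 1 / \<delta>\<^sup>2 * (f x - g x)"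
    proof -
      have "((1 / (c * k))\<^sup>2 + (1 / \<delta>)\<^sup>2) * k = 1 / c\<^sup>2 * (1 / k) + 1 / \<delta>\<^sup>2 * k" if "0 < k" for k
        using that by (simp add: field_simps power2_eq_square)
      then show ?thesis using h by blast
    qed
    finally have "ennreal ((m x)\<^sup>2) * ennreal (f x - g x)
        \<le> ennreal (1 / c\<^sup>2) * ennreal (1 / (f x - g x)) + ennreal (1 / \<delta>\<^sup>2) * ennreal (f x - g x)"
      using h by (simp add: ennreal_leI flip: ennreal_mult ennreal_plus)
    then show "ennreal ((m x)\<^sup>2) * indicator {- (1/2)..<1/2} x * ennreal (f x - g x)
      \<le> ennreal (1 / c\<^sup>2) * (ennreal (1 / (f x - g x)) * indicator {- (1/2)..1/2} x)
        + ennreal (1 / \<delta>\<^sup>2) * (ennreal (f x - g x) * indicator {- (1/2)..1/2} x)"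
      by (auto split: split_indicator)
  qed
  also have "\<dots> = ennreal (1 / c\<^sup>2) * (\<integral>\<^sup>+x\<in>{- (1/2)..1/2}. ennreal (1 / (f x - g x)) \<partial>lborel)
      + ennreal (1 / \<delta>\<^sup>2) * (\<integral>\<^sup>+x\<in>{- (1/2)..1/2}. ennreal (f x - g x) \<partial>lborel)"
    by (subst nn_integral_add) (simp_all add: nn_integral_cmult)
  finally show ?thesis .
qed

lemma emeasure_region_between:
  assumes contf: "continuous_on UNIV f" and contg: "continuous_on UNIV g" and less: "\<And>x. g x < f x"
  shows "emeasure lborel (region_between f g \<inter> {z. - (1/2) \<le> Re z \<and> Re z \<le> 1/2})
    = (\<integral>\<^sup>+x\<in>{- (1/2)..1/2}. ennreal (f x - g x) \<partial>lborel)"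
proof -
  have [measurable]: "f \<in> borel_measurable borel" "g \<in> borel_measurable borel"
    using contf contg by (auto intro: borel_measurable_continuous_onI)
  let ?A = "region_between f g \<inter> {z. - (1/2) \<le> Re z \<and> Re z \<le> 1/2}"
  have [measurable]: "?A \<in> sets borel"
    unfolding region_between_def by measurable
  have "emeasure lborel ?A = (\<integral>\<^sup>+z. indicator ?A z \<partial>lborel)"
    by (rule nn_integral_indicator[symmetric]) measurable
  also have "\<dots> = (\<integral>\<^sup>+x. \<integral>\<^sup>+y. indicator ?A (Complex x y) \<partial>lborel \<partial>lborel)"
    by (rule nn_integral_complex_iterated) measurable
  also have "\<dots> = (\<integral>\<^sup>+x. \<integral>\<^sup>+y. indicator {- (1/2)..1/2} x * indicator {g x<..<f x} y \<partial>lborel \<partial>lborel)"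
    by (intro nn_integral_cong) (auto simp: region_between_def split: split_indicator)
  also have "\<dots> = (\<integral>\<^sup>+x\<in>{- (1/2)..1/2}. ennreal (f x - g x) \<partial>lborel)"
    using less by (intro nn_integral_cong) (simp add: nn_integral_cmult less_imp_le mult.commute[of "indicator {- (1/2)..1/2} _" "ennreal _"])
  finally show ?thesis .
qed

section \<open>Comparison of the two moduli\<close>

text \<open>Here \<open>d\<close> converts the area term \<open>1/\<delta>\<^sup>2\<close> into a multiple of the modulus \<open>M\<close> of the vertical
  segments. To pass to the quotient one also needs \<open>M\<close> to be finite, which follows from the same
  upper bound because \<open>1/h\<close> is bounded on a period.\<close>

lemma modulus_comparison:
  assumes contf: "continuous_on UNIV f" and contg: "continuous_on UNIV g"
    and perf: "\<And>x. f (x + 1) = f x" and perg: "\<And>x. g (x + 1) = g x"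
    and less: "\<And>x. g x < f x" and pos: "0 < c" "0 < d" "0 < \<delta>"
    and narrow: "\<And>x a b. \<bar>a - x\<bar> \<le> \<delta> \<Longrightarrow> \<bar>b - x\<bar> \<le> \<delta> \<Longrightarrow> c * (f x - g x) \<le> f a - g b"
    and area: "emeasure lborel (region_between f g \<inter> {z. - (1/2) \<le> Re z \<and> Re z \<le> 1/2}) \<le> 1"
    and d: "ennreal d \<le> ennreal (\<delta>\<^sup>2) * modulus (vertical_segments f g)"
  shows "cylinder_modulus (connecting_curves (region_between f g) f g)
    / modulus (vertical_segments f g) \<in> {1..ennreal (1 / c\<^sup>2 + 1 / d)}"
proof -
  define N where "N = cylinder_modulus (connecting_curves (region_between f g) f g)"
  define M where "M = modulus (vertical_segments f g)"
  define I where "I = (\<integral>\<^sup>+x\<in>{- (1/2)..1/2}. ennreal (1 / (f x - g x)) \<partial>lborel)"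
  have "M \<le> N"
    unfolding M_def N_def using less
    by (intro modulus_vertical_segments_le_cylinder_modulus vertical_segments_subset_connecting_curves)
  have "I \<le> M"
    unfolding I_def M_def by (rule modulus_vertical_segments_ge[OF contf contg less])
  have N: "N \<le> ennreal (1 / c\<^sup>2) * I + ennreal (1 / \<delta>\<^sup>2)"
  proof -
    have "N \<le> ennreal (1 / c\<^sup>2) * I
        + ennreal (1 / \<delta>\<^sup>2) * emeasure lborel (region_between f g \<inter> {z. - (1/2) \<le> Re z \<and> Re z \<le> 1/2})"
      unfolding N_def I_def emeasure_region_between[OF contf contg less]
      by (rule cylinder_modulus_connecting_curves_le[OF contf contg perf perg less pos(1,3) narrow])
    also have "\<dots> \<le> ennreal (1 / c\<^sup>2) * I + ennreal (1 / \<delta>\<^sup>2) * 1"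
      by (intro add_left_mono mult_left_mono area) simp
    finally show ?thesis by simp
  qed
  have "I < \<infinity>"
  proof -
    have "continuous_on {- (1/2)..1/2} (\<lambda>x. 1 / (f x - g x))"
      using less by (intro continuous_intros continuous_on_subset[OF contf] continuous_on_subset[OF contg])
        (auto simp: less_imp_neq[symmetric])
    then have "bounded ((\<lambda>x. 1 / (f x - g x)) ` {- (1/2)..1/2})"
      by (intro compact_imp_bounded compact_continuous_image) auto
    then obtain K where "\<forall>y \<in> (\<lambda>x. 1 / (f x - g x)) ` {- (1/2)..1/2}. norm y \<le> K"
      unfolding bounded_iff by blast
    then have K: "1 / (f x - g x) \<le> K" if "x \<in> {- (1/2)..1/2}" for x
      using that by (auto simp: abs_le_iff simp del: abs_divide)
    have "I \<le> (\<integral>\<^sup>+x. ennreal K * indicator {- (1/2)..1/2::real} x \<partial>lborel)"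
      unfolding I_def using K
      by (intro nn_integral_mono) (simp add: ennreal_leI split: split_indicator)
    also have "\<dots> < \<infinity>" by (simp add: nn_integral_cmult ennreal_mult_less_top)
    finally show ?thesis .
  qed
  then have "N < \<infinity>"
    using N by (auto intro!: le_less_trans[OF N] simp: ennreal_mult_less_top)
  then have "M < \<infinity>" using \<open>M \<le> N\<close> by (rule le_less_trans[rotated])
  have "M \<noteq> 0" using d pos by (auto simp: M_def)
  have "ennreal (1 / \<delta>\<^sup>2) \<le> ennreal (1 / d) * M"
  proof -
    have "ennreal (1 / \<delta>\<^sup>2) = ennreal (1 / d) * (ennreal (1 / \<delta>\<^sup>2) * ennreal d)"
      using pos by (simp flip: ennreal_mult)
    also have "\<dots> \<le> ennreal (1 / d) * (ennreal (1 / \<delta>\<^sup>2) * (ennreal (\<delta>\<^sup>2) * M))"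
      unfolding M_def by (intro mult_left_mono d) auto
    also have "ennreal (1 / \<delta>\<^sup>2) * (ennreal (\<delta>\<^sup>2) * M) = M"
      using pos by (simp add: mult.assoc[symmetric] flip: ennreal_mult)
    finally show ?thesis .
  qed
  then have "N \<le> ennreal (1 / c\<^sup>2) * M + ennreal (1 / d) * M"
    using N \<open>I \<le> M\<close> by (meson add_mono mult_left_mono order_trans zero_le)
  also have "\<dots> = ennreal (1 / c\<^sup>2 + 1 / d) * M"
    using pos by (simp add: distrib_right)
  finally have NC: "N \<le> ennreal (1 / c\<^sup>2 + 1 / d) * M" .
  have MM: "M / M = 1" using \<open>M \<noteq> 0\<close> \<open>M < \<infinity>\<close> by (simp add: ennreal_divide_self)
  have "M / M \<le> N / M" using \<open>M \<le> N\<close> by (rule divide_right_mono_ennreal)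
  moreover have "N / M \<le> ennreal (1 / c\<^sup>2 + 1 / d) * M / M" using NC by (rule divide_right_mono_ennreal)
  ultimately show ?thesis
    unfolding M_def[symmetric] N_def[symmetric]
    by (simp add: MM ennreal_times_divide[symmetric])
qed

lemma c_const_lower_bound:
  assumes c: "ereal c \<le> c_const f g \<delta>" and "g x < f x" and "\<bar>a - x\<bar> \<le> \<delta>" "\<bar>b - x\<bar> \<le> \<delta>"
  shows "c * (f x - g x) \<le> f a - g b"
proof -
  let ?I = "INF (a, b) \<in> {x - \<delta>..x + \<delta>} \<times> {x - \<delta>..x + \<delta>}. ereal (f a - g b)"
  have h: "0 < f x - g x" using assms by simp
  have "?I \<le> (case (a, b) of (a, b) \<Rightarrow> ereal (f a - g b))"
    using assms by (intro INF_lower) (auto simp: abs_le_iff)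
  then have I: "?I \<le> ereal (f a - g b)" by simp
  have "ereal c \<le> ?I / ereal (f x - g x)"
    using c by (rule order_trans) (auto simp: c_const_def intro: INF_lower)
  also have "\<dots> \<le> ereal (f a - g b) / ereal (f x - g x)"
    using I h by (intro ereal_divide_right_mono) auto
  also have "\<dots> = ereal ((f a - g b) / (f x - g x))"
    using h by simp
  finally show ?thesis using h by (simp add: pos_le_divide_eq)
qed

lemma comparison_constant_unbounded:
  "\<exists>\<epsilon>>0. \<forall>c>0. \<forall>d>0. c < \<epsilon> \<or> d < \<epsilon> \<longrightarrow> M < 1 + 1 / c\<^sup>2 + 1 / (d::real)"
proof -
  define K where "K = max M 1"
  have K: "M \<le> K" "1 \<le> K" by (simp_all add: K_def)
  have inv: "K < 1 / t" if "t < 1 / K" "0 < t" for t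
    using that K by (simp add: field_simps)
  have "M < 1 + 1 / c\<^sup>2 + 1 / d" if pos: "0 < c" "0 < d" and "c < 1 / K \<or> d < 1 / K" for c d
    using that(3)
  proof
    assume c: "c < 1 / K"
    have "1 / K \<le> 1" using K by simp
    then have "c\<^sup>2 \<le> c" using c pos by (simp add: power2_eq_square mult_left_le)
    then have "1 / c \<le> 1 / c\<^sup>2" using pos by (intro divide_left_mono) auto
    then show ?thesis using inv[OF c pos(1)] K pos by (smt (verit) zero_less_divide_1_iff)
  next
    assume d: "d < 1 / K"
    have "0 < 1 / c\<^sup>2" using pos by simp
    then show ?thesis using inv[OF d pos(2)] K by linarith
  qed
  moreover have "0 < 1 / K" using K by simp
  ultimately show ?thesis by blast
qed

theorem corollary5p3:
  shows "\<exists>C :: real \<Rightarrow> real \<Rightarrow> real.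
    (\<forall>c>0. \<forall>d>0. 1 \<le> C c d) \<and>
    (\<forall>M. \<exists>\<epsilon>>0. \<forall>c>0. \<forall>d>0. c < \<epsilon> \<or> d < \<epsilon> \<longrightarrow> M < C c d) \<and>
    (\<forall>(c::real) (d::real) (l0::real)
      (G :: real \<Rightarrow> (complex \<Rightarrow> complex) set) (R :: real \<Rightarrow> complex set set)
      (T :: real \<Rightarrow> complex set) (f :: real \<Rightarrow> real \<Rightarrow> real) (g :: real \<Rightarrow> real \<Rightarrow> real)
      (\<delta> :: real \<Rightarrow> real).
      0 < l0 \<longrightarrow>
      (\<forall>l\<ge>l0. deck_group (G l) \<and> axis_simple_closed_geodesic (G l) l \<and>
        (collar (G l) (R l) \<or> half_collar (G l) (R l)) \<and>
        log_lift (G l) l (R l) (T l) \<and> boundary_functions (T l) (f l) (g l)) \<longrightarrow>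
      simply_degenerate l0 f g \<longrightarrow>
      (\<forall>l\<ge>l0. 0 < \<delta> l \<and> \<delta> l \<le> 1) \<longrightarrow>
      ennreal d = (INF l\<in>{l0..}. ennreal ((\<delta> l)\<^sup>2) * modulus (vertical_segments (f l) (g l))) \<longrightarrow>
      0 < d \<longrightarrow>
      ereal c = (INF l\<in>{l0..}. c_const (f l) (g l) (\<delta> l)) \<longrightarrow>
      0 < c \<longrightarrow>
      (\<forall>\<^sub>F l in at_top.
        cylinder_modulus (connecting_curves (T l) (f l) (g l))
          / modulus (vertical_segments (f l) (g l)) \<in> {ennreal (1 / C c d)..ennreal (C c d)}))"
proof (intro exI[of _ "\<lambda>c d. 1 + 1 / c\<^sup>2 + 1 / d"] conjI)
  show "\<forall>c>0. \<forall>d>0. 1 \<le> 1 + 1 / c\<^sup>2 + 1 / (d::real)" by simp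
  show "\<forall>M. \<exists>\<epsilon>>0. \<forall>c>0. \<forall>d>0. c < \<epsilon> \<or> d < \<epsilon> \<longrightarrow> M < 1 + 1 / c\<^sup>2 + 1 / (d::real)"
    using comparison_constant_unbounded by blast
next
  show "\<forall>(c::real) (d::real) (l0::real)
      (G :: real \<Rightarrow> (complex \<Rightarrow> complex) set) (R :: real \<Rightarrow> complex set set)
      (T :: real \<Rightarrow> complex set) (f :: real \<Rightarrow> real \<Rightarrow> real) (g :: real \<Rightarrow> real \<Rightarrow> real)
      (\<delta> :: real \<Rightarrow> real).
      0 < l0 \<longrightarrow>
      (\<forall>l\<ge>l0. deck_group (G l) \<and> axis_simple_closed_geodesic (G l) l \<and>
        (collar (G l) (R l) \<or> half_collar (G l) (R l)) \<and>
        log_lift (G l) l (R l) (T l) \<and> boundary_functions (T l) (f l) (g l)) \<longrightarrow>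
      simply_degenerate l0 f g \<longrightarrow>
      (\<forall>l\<ge>l0. 0 < \<delta> l \<and> \<delta> l \<le> 1) \<longrightarrow>
      ennreal d = (INF l\<in>{l0..}. ennreal ((\<delta> l)\<^sup>2) * modulus (vertical_segments (f l) (g l))) \<longrightarrow>
      0 < d \<longrightarrow>
      ereal c = (INF l\<in>{l0..}. c_const (f l) (g l) (\<delta> l)) \<longrightarrow>
      0 < c \<longrightarrow>
      (\<forall>\<^sub>F l in at_top.
        cylinder_modulus (connecting_curves (T l) (f l) (g l))
          / modulus (vertical_segments (f l) (g l))
          \<in> {ennreal (1 / (1 + 1 / c\<^sup>2 + 1 / d))..ennreal (1 + 1 / c\<^sup>2 + 1 / d)})"
  proof (intro allI impI)
    fix c d l0 :: real and G :: "real \<Rightarrow> (complex \<Rightarrow> complex) set" and R T f g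
      and \<delta> :: "real \<Rightarrow> real"
    assume bd: "\<forall>l\<ge>l0. deck_group (G l) \<and> axis_simple_closed_geodesic (G l) l \<and>
        (collar (G l) (R l) \<or> half_collar (G l) (R l)) \<and>
        log_lift (G l) l (R l) (T l) \<and> boundary_functions (T l) (f l) (g l)"
      and deg: "simply_degenerate l0 f g"
      and \<delta>: "\<forall>l\<ge>l0. 0 < \<delta> l \<and> \<delta> l \<le> 1"
      and d: "ennreal d = (INF l\<in>{l0..}. ennreal ((\<delta> l)\<^sup>2) * modulus (vertical_segments (f l) (g l)))"
      and "0 < d"
      and c: "ereal c = (INF l\<in>{l0..}. c_const (f l) (g l) (\<delta> l))"
      and "0 < c"
    show "\<forall>\<^sub>F l in at_top.
        cylinder_modulus (connecting_curves (T l) (f l) (g l))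
          / modulus (vertical_segments (f l) (g l))
          \<in> {ennreal (1 / (1 + 1 / c\<^sup>2 + 1 / d))..ennreal (1 + 1 / c\<^sup>2 + 1 / d)}"
      using eventually_ge_at_top[of l0]
    proof eventually_elim
      case (elim l)
      have f: "continuous_on UNIV (f l)" "\<And>x. f l (x + 1) = f l x"
        and g: "continuous_on UNIV (g l)" "\<And>x. g l (x + 1) = g l x"
        and less: "\<And>x. g l x < f l x" and T: "T l = region_between (f l) (g l)"
        using bd elim by (auto simp: boundary_functions_def)
      have cl: "ereal c \<le> c_const (f l) (g l) (\<delta> l)"
        unfolding c using elim by (intro INF_lower) simp
      have dl: "ennreal d \<le> ennreal ((\<delta> l)\<^sup>2) * modulus (vertical_segments (f l) (g l))"
        unfolding d using elim by (intro INF_lower) simp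
      have "cylinder_modulus (connecting_curves (T l) (f l) (g l))
          / modulus (vertical_segments (f l) (g l)) \<in> {1..ennreal (1 / c\<^sup>2 + 1 / d)}"
        unfolding T
      proof (rule modulus_comparison[OF f(1) g(1) f(2) g(2) less \<open>0 < c\<close> \<open>0 < d\<close> _ _ _ dl])
        show "0 < \<delta> l" using \<delta> elim by simp
        show "emeasure lborel (region_between (f l) (g l) \<inter> {z. - (1/2) \<le> Re z \<and> Re z \<le> 1/2}) \<le> 1"
          using deg elim by (simp add: simply_degenerate_def)
        show "c * (f l x - g l x) \<le> f l a - g l b" if "\<bar>a - x\<bar> \<le> \<delta> l" "\<bar>b - x\<bar> \<le> \<delta> l" for x a b
          using cl less that by (rule c_const_lower_bound)
      qed
      moreover have "ennreal (1 / (1 + 1 / c\<^sup>2 + 1 / d)) \<le> 1"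
      proof -
        have "0 \<le> 1 / c\<^sup>2 + 1 / d" using \<open>0 < d\<close> by simp
        then have "1 / (1 + 1 / c\<^sup>2 + 1 / d) \<le> 1" by (subst divide_le_eq_1_pos) linarith+
        then show ?thesis by (metis ennreal_1 ennreal_leI)
      qed
      moreover have "ennreal (1 / c\<^sup>2 + 1 / d) \<le> ennreal (1 + 1 / c\<^sup>2 + 1 / d)"
        by (rule ennreal_leI) simp
      ultimately show ?case by (meson atLeastAtMost_iff order_trans)
    qed
  qed
qed

end
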